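(* Let $K$ be a field, let $(\mathfrak{L},\delta,r)$ be a cosymplectic Leibniz coalgebra over $K$ and let $\omega\in(\mathfrak{L}\otimes\mathfrak{L})^*$. Suppose that $(\mathfrak{L},\delta,\omega,[,]_\omega)$ is a dual triangular Leibniz bialgebra, where, writing $\delta(x)=x_{(1)}\otimes x_{(2)}$, $$[x,y]_\omega=-\omega(x,y_{(1)})y_{(2)}+\omega(y,x_{(1)})x_{(2)}+x_{(1)}\omega(y,x_{(2)}),$$ and that $(\mathfrak{L},[,]_\omega,r,\delta_r)$ is a triangular Leibniz bialgebra, where $$\delta_r(x)=-r^{1}\otimes [r^{2}, x]_\omega+[r^{2}, x]_\omega\otimes r^{1}+[x, r^{2}]_\omega\otimes r^{1}.$$ Define a linear map $S:\mathfrak{L}\to\mathfrak{L}$ by $S(x)=r^1\omega(r^2,x)$ for all $x\in\mathfrak{L}$. Then $(\mathfrak{L},\delta,S)$ is a Nijenhuis Leibniz coalgebra.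
   Context: All vector spaces, tensor products and linear maps are over a fixed field $K$; summation is understood in $r=r^1\otimes r^2$ (with $\bar r=\bar r^1\otimes\bar r^2$ a second copy of $r$) and in Sweedler notation $\delta(x)=x_{(1)}\otimes x_{(2)}$. A (left) Leibniz algebra $(\mathfrak{L},[,])$: bilinear bracket with $[x,[y,z]]=[[x,y],z]+[y,[x,z]]$ for all $x,y,z$. A Leibniz coalgebra $(\mathfrak{L},\delta)$: linear $\delta:\mathfrak{L}\to\mathfrak{L}\otimes\mathfrak{L}$ with $x_{(1)}\otimes x_{(2)(1)}\otimes x_{(2)(2)}=x_{(1)(1)}\otimes x_{(1)(2)}\otimes x_{(2)}+x_{(2)(1)}\otimes x_{(1)}\otimes x_{(2)(2)}$ for all $x$. A Leibniz bialgebra $(\mathfrak{L},[,],\delta)$: a Leibniz algebra and a Leibniz coalgebra such that for all $x,y$: $0=x_{(2)}\otimes [x_{(1)}, y]-[y_{(1)}, x]\otimes y_{(2)}$ and $\delta([x,y])=x_{(1)}\otimes [x_{(2)}, y]-[y, x_{(1)}]\otimes x_{(2)}-[x_{(1)}, y]\otimes x_{(2)}+x_{(2)}\otimes [x_{(1)}, y]-[y, x_{(2)}]\otimes x_{(1)}-[x_{(2)}, y]\otimes x_{(1)}+[x, y_{(1)}]\otimes y_{(2)}+y_{(1)}\otimes [x, y_{(2)}]$. Triangular: $(\mathfrak{L},[,],r,\delta_r)$, with $\delta_r(x)=-r^{1}\otimes [r^{2}, x]+[r^{2}, x]\otimes r^{1}+[x, r^{2}]\otimes r^{1}$, is a triangular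 Leibniz bialgebra if $(\mathfrak{L},[,])$ is a Leibniz algebra and $r$ is symmetric ($r^1\otimes r^2=r^2\otimes r^1$) and solves the classical Leibniz Yang-Baxter equation in $(\mathfrak{L},[,])$: $$r^1\otimes[r^2,\bar r^1]\otimes\bar r^2+r^1\otimes\bar r^1\otimes[r^2,\bar r^2]=[r^2,\bar r^1]\otimes r^1\otimes\bar r^2+[r^1,\bar r^2]\otimes\bar r^1\otimes r^2$$ (it is known that then $(\mathfrak{L},[,],\delta_r)$ is a Leibniz bialgebra). Dual triangular: $(\mathfrak{L},\delta,\omega,[,]_\omega)$ is a dual triangular Leibniz bialgebra if $(\mathfrak{L},\delta)$ is a Leibniz coalgebra and the bilinear form $\omega$ is symmetric ($\omega(x,y)=\omega(y,x)$) and solves the co-classical Leibniz Yang-Baxter equation in $(\mathfrak{L},\delta)$: for all $x,y,z$, $$\omega(x,y_{(1)})\omega(y_{(2)},z)+\omega(x,z_{(1)})\omega(y,z_{(2)})=\omega(y,x_{(1)})\omega(x_{(2)},z)+\omega(x_{(1)},z)\omega(y,x_{(2)})$$ (then $(\mathfrak{L},[,]_\omega,\delta)$ is a Leibniz bialgebra). Cosymplectic Leibniz coalgebra $(\mathfrak{L},\delta,r)$: a Leibniz coalgebra with a symmetric tensor $r\in\mathfrak{L}\otimes\mathfrak{L}$ such that $${r^1}_{(1)}\otimes {r^1}_{(2)}\otimes r^2+{r^1}_{(1)}\otimes r^2\otimes {r^1}_{(2)}=r^2\otimes {r^1}_{(1)}\otimes {r^1}_{(2)}+r^2\otimes {r^1}_{(2)}\otimes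 {r^1}_{(1)},$$ where $\delta(r^1)={r^1}_{(1)}\otimes{r^1}_{(2)}$. Nijenhuis Leibniz coalgebra $(\mathfrak{L},\delta,S)$: a Leibniz coalgebra with a linear map $S:\mathfrak{L}\to\mathfrak{L}$ such that for all $x$: $S(x_{(1)})\otimes S(x_{(2)})+S^2(x)_{(1)}\otimes S^2(x)_{(2)}=S(S(x)_{(1)})\otimes S(x)_{(2)}+S(x)_{(1)}\otimes S(S(x)_{(2)})$, where $\delta(S(x))=S(x)_{(1)}\otimes S(x)_{(2)}$ and $\delta(S^2(x))=S^2(x)_{(1)}\otimes S^2(x)_{(2)}$. *)

theory Defs
  imports Complex_Main "HOL-Library.Poly_Mapping"
begin

section \<open>Free vector spaces\<close>

definition fscale :: "'k::field \<Rightarrow> ('i \<Rightarrow>\<^sub>0 'k) \<Rightarrow> ('i \<Rightarrow>\<^sub>0 'k)" where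
  "fscale c t = Poly_Mapping.map (\<lambda>a. c * a) t"

abbreviation gen :: "'i \<Rightarrow> ('i \<Rightarrow>\<^sub>0 'k::field)" where
  "gen i \<equiv> Poly_Mapping.single i 1"

lemma lookup_fscale [simp]: "Poly_Mapping.lookup (fscale c t) i = c * Poly_Mapping.lookup t i"
  unfolding fscale_def by (simp add: Poly_Mapping.map.rep_eq when_def)

lemma vector_space_fscale: "vector_space (fscale :: 'k::field \<Rightarrow> ('i \<Rightarrow>\<^sub>0 'k) \<Rightarrow> _)"
  by unfold_locales (auto intro!: poly_mapping_eqI simp: lookup_add algebra_simps)

interpretation free: vector_space "fscale :: 'k::field \<Rightarrow> ('i \<Rightarrow>\<^sub>0 'k) \<Rightarrow> _"
  by (rule vector_space_fscale)

text \<open>The linear extension of \<open>f\<close> from generators to the free vector space; \<open>sc\<close> is the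
  scalar multiplication of the target.\<close>

definition lin_ext :: "('k::field \<Rightarrow> 'w \<Rightarrow> 'w::ab_group_add) \<Rightarrow> ('i \<Rightarrow> 'w) \<Rightarrow> ('i \<Rightarrow>\<^sub>0 'k) \<Rightarrow> 'w" where
  "lin_ext sc f t = (\<Sum>i\<in>Poly_Mapping.keys t. sc (Poly_Mapping.lookup t i) (f i))"


section \<open>Tensor products\<close>

text \<open>\<open>L \<otimes> L\<close> and \<open>L \<otimes> L \<otimes> L\<close> are the quotients of the free vector spaces on \<open>L \<times> L\<close> and
  \<open>L \<times> L \<times> L\<close> by the span of the multilinearity relations. A tensor is a coset, so that equality
  of tensors is equality of sets.\<close>

definition coset :: "('i \<Rightarrow>\<^sub>0 'k::field) set \<Rightarrow> ('i \<Rightarrow>\<^sub>0 'k) \<Rightarrow> ('i \<Rightarrow>\<^sub>0 'k) set" where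
  "coset N t = {u. u - t \<in> N}"

definition rep :: "('i \<Rightarrow>\<^sub>0 'k::field) set \<Rightarrow> ('i \<Rightarrow>\<^sub>0 'k)" where
  "rep T = (SOME t. t \<in> T)"

definition bilinear_relations ::
    "('k::field \<Rightarrow> 'v \<Rightarrow> 'v::ab_group_add) \<Rightarrow> ('v \<times> 'v \<Rightarrow>\<^sub>0 'k) set" where
  "bilinear_relations scale =
     {gen (x + x', y) - gen (x, y) - gen (x', y) | x x' y. True} \<union>
     {gen (x, y + y') - gen (x, y) - gen (x, y') | x y y'. True} \<union>
     {gen (scale c x, y) - fscale c (gen (x, y)) | c x y. True} \<union>
     {gen (x, scale c y) - fscale c (gen (x, y)) | c x y. True}"

definition trilinear_relations ::
    "('k::field \<Rightarrow> 'v \<Rightarrow> 'v::ab_group_add) \<Rightarrow> ('v \<times> 'v \<times> 'v \<Rightarrow>\<^sub>0 'k) set" where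
  "trilinear_relations scale =
     {gen (x + x', y, z) - gen (x, y, z) - gen (x', y, z) | x x' y z. True} \<union>
     {gen (x, y + y', z) - gen (x, y, z) - gen (x, y', z) | x y y' z. True} \<union>
     {gen (x, y, z + z') - gen (x, y, z) - gen (x, y, z') | x y z z'. True} \<union>
     {gen (scale c x, y, z) - fscale c (gen (x, y, z)) | c x y z. True} \<union>
     {gen (x, scale c y, z) - fscale c (gen (x, y, z)) | c x y z. True} \<union>
     {gen (x, y, scale c z) - fscale c (gen (x, y, z)) | c x y z. True}"

definition tensor2 ::
    "('k::field \<Rightarrow> 'v \<Rightarrow> 'v::ab_group_add) \<Rightarrow> ('v \<times> 'v \<Rightarrow>\<^sub>0 'k) \<Rightarrow> ('v \<times> 'v \<Rightarrow>\<^sub>0 'k) set" where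
  "tensor2 scale = coset (free.span (bilinear_relations scale))"

definition tensor3 ::
    "('k::field \<Rightarrow> 'v \<Rightarrow> 'v::ab_group_add) \<Rightarrow> ('v \<times> 'v \<times> 'v \<Rightarrow>\<^sub>0 'k) \<Rightarrow> ('v \<times> 'v \<times> 'v \<Rightarrow>\<^sub>0 'k) set" where
  "tensor3 scale = coset (free.span (trilinear_relations scale))"

definition tensor_square ::
    "('k::field \<Rightarrow> 'v \<Rightarrow> 'v::ab_group_add) \<Rightarrow> ('v \<times> 'v \<Rightarrow>\<^sub>0 'k) set set" where
  "tensor_square scale = range (tensor2 scale)"

definition tensor_add ::
    "('k::field \<Rightarrow> 'v \<Rightarrow> 'v::ab_group_add) \<Rightarrow> ('v \<times> 'v \<Rightarrow>\<^sub>0 'k) set \<Rightarrow> ('v \<times> 'v \<Rightarrow>\<^sub>0 'k) set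
      \<Rightarrow> ('v \<times> 'v \<Rightarrow>\<^sub>0 'k) set" where
  "tensor_add scale T U = tensor2 scale (rep T + rep U)"

definition tensor_scale ::
    "('k::field \<Rightarrow> 'v \<Rightarrow> 'v::ab_group_add) \<Rightarrow> 'k \<Rightarrow> ('v \<times> 'v \<Rightarrow>\<^sub>0 'k) set
      \<Rightarrow> ('v \<times> 'v \<Rightarrow>\<^sub>0 'k) set" where
  "tensor_scale scale c T = tensor2 scale (fscale c (rep T))"

definition pure2 ::
    "('k::field \<Rightarrow> 'v \<Rightarrow> 'v::ab_group_add) \<Rightarrow> 'v \<Rightarrow> 'v \<Rightarrow> ('v \<times> 'v \<Rightarrow>\<^sub>0 'k) set" where
  "pure2 scale x y = tensor2 scale (gen (x, y))"

text \<open>Sweedler summation: \<open>sweedler sc T f\<close> is the sum of \<open>f a b\<close> over a presentation of the tensor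
  \<open>T\<close> as a linear combination of pure tensors \<open>a \<otimes> b\<close>. Tensor-valued sums are formed in the free
  vector space (\<open>sc = fscale\<close>) and then projected by \<open>tensor2\<close> or \<open>tensor3\<close>. The chosen presentation is
  irrelevant as soon as \<open>f\<close> is bilinear, possibly only modulo a subspace: see
  \<open>sweedler_well_defined\<close> below.\<close>

definition sweedler ::
    "('k::field \<Rightarrow> 'w \<Rightarrow> 'w::ab_group_add) \<Rightarrow> ('v \<times> 'v \<Rightarrow>\<^sub>0 'k) set \<Rightarrow> ('v \<Rightarrow> 'v \<Rightarrow> 'w) \<Rightarrow> 'w" where
  "sweedler sc T f = lin_ext sc (\<lambda>(a, b). f a b) (rep T)"

abbreviation fsweedler ::
    "('v \<times> 'v \<Rightarrow>\<^sub>0 'k::field) set \<Rightarrow> ('v \<Rightarrow> 'v \<Rightarrow> ('i \<Rightarrow>\<^sub>0 'k)) \<Rightarrow> ('i \<Rightarrow>\<^sub>0 'k)" where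
  "fsweedler \<equiv> sweedler fscale"


subsection \<open>Independence of presentations\<close>

lemma coset_eq_iff:
  assumes "free.subspace N"
  shows "coset N t = coset N u \<longleftrightarrow> t - u \<in> N"
proof
  assume "coset N t = coset N u"
  moreover have "t \<in> coset N t"
    using free.subspace_0[OF assms] by (simp add: coset_def)
  ultimately show "t - u \<in> N" by (simp add: coset_def)
next
  assume tu: "t - u \<in> N"
  have "w - t \<in> N \<longleftrightarrow> w - u \<in> N" for w
    using free.subspace_add[OF assms _ tu, of "w - t"] free.subspace_diff[OF assms _ tu, of "w - u"]
    by auto
  then show "coset N t = coset N u" by (simp add: coset_def)
qed

lemma rep_coset:
  assumes "free.subspace N"
  shows "rep (coset N t) - t \<in> N"
proof -
  have "t \<in> coset N t"
    using free.subspace_0[OF assms] by (simp add: coset_def)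
  then have "rep (coset N t) \<in> coset N t"
    unfolding rep_def by (rule someI)
  then show ?thesis by (simp add: coset_def)
qed

lemma lin_ext_superset:
  assumes "vector_space sc" "finite A" "Poly_Mapping.keys t \<subseteq> A"
  shows "lin_ext sc f t = (\<Sum>i\<in>A. sc (Poly_Mapping.lookup t i) (f i))"
proof -
  interpret vector_space sc by fact
  show ?thesis
    unfolding lin_ext_def
    by (rule sum.mono_neutral_left) (use assms in \<open>auto simp: in_keys_iff\<close>)
qed

lemma linear_lin_ext:
  assumes "vector_space sc"
  shows "Vector_Spaces.linear fscale sc (lin_ext sc f)"
proof -
  interpret W: vector_space sc by fact
  have add: "lin_ext sc f (t + u) = lin_ext sc f t + lin_ext sc f u" for t u
  proof -
    let ?A = "Poly_Mapping.keys t \<union> Poly_Mapping.keys u"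
    have "Poly_Mapping.keys (t + u) \<subseteq> ?A" by (rule keys_add)
    then show ?thesis
      by (simp add: lin_ext_superset[OF assms, of ?A] lookup_add W.scale_left_distrib sum.distrib)
  qed
  have scale: "lin_ext sc f (fscale c t) = sc c (lin_ext sc f t)" for c t
  proof -
    have "Poly_Mapping.keys (fscale c t) \<subseteq> Poly_Mapping.keys t" by (auto simp: in_keys_iff)
    then show ?thesis
      by (simp add: lin_ext_superset[OF assms, of "Poly_Mapping.keys t"] W.scale_sum_right)
  qed
  show ?thesis
    by (rule Vector_Spaces.linear_iff[THEN iffD2])
      (simp add: add scale assms vector_space_fscale)
qed

lemma lin_ext_gen [simp]:
  assumes "vector_space sc"
  shows "lin_ext sc f (gen i) = f i"
proof -
  interpret W: vector_space sc by fact
  show ?thesis by (simp add: lin_ext_def)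
qed

lemma sweedler_well_defined:
  fixes scale :: "'k::field \<Rightarrow> 'v \<Rightarrow> 'v::ab_group_add"
    and sc :: "'k \<Rightarrow> 'w \<Rightarrow> 'w::ab_group_add"
  assumes W: "vector_space sc" and N: "module.subspace sc N"
    and "\<And>x x' y. f (x + x') y - f x y - f x' y \<in> N"
    and "\<And>x y y'. f x (y + y') - f x y - f x y' \<in> N"
    and "\<And>c x y. f (scale c x) y - sc c (f x y) \<in> N"
    and "\<And>c x y. f x (scale c y) - sc c (f x y) \<in> N"
  shows "sweedler sc (tensor2 scale t) f - lin_ext sc (\<lambda>(a, b). f a b) t \<in> N"
proof -
  interpret W: vector_space sc by fact
  let ?F = "lin_ext sc (\<lambda>(a, b). f a b)"
  interpret F: Vector_Spaces.linear fscale sc ?F by (rule linear_lin_ext[OF W])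
  have "?F u \<in> N" if "u \<in> free.span (bilinear_relations scale)" for u
  proof -
    have "free.span (bilinear_relations scale) \<subseteq> ?F -` N"
    proof (rule free.span_minimal)
      show "bilinear_relations scale \<subseteq> ?F -` N"
        using assms(3-)
        by (auto simp: bilinear_relations_def F.diff F.scale lin_ext_gen[OF W])
      show "free.subspace (?F -` N)"
        using F.subspace_vimage[OF N] .
    qed
    then show ?thesis using that by auto
  qed
  moreover have "rep (tensor2 scale t) - t \<in> free.span (bilinear_relations scale)"
    unfolding tensor2_def by (rule rep_coset) (rule free.subspace_span)
  ultimately have "?F (rep (tensor2 scale t) - t) \<in> N" by blast
  then show ?thesis by (simp add: sweedler_def F.diff)
qed


section \<open>Linear maps and forms\<close>

text \<open>Linear maps \<open>L \<rightarrow> L \<otimes> L\<close> and linear forms on \<open>L \<otimes> L\<close>; \<open>L \<otimes> L\<close> is not a type, so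
  \<open>Vector_Spaces.linear\<close> does not apply. The values of a form outside \<open>L \<otimes> L\<close> are irrelevant.\<close>

definition linear_to_tensor_square ::
    "('k::field \<Rightarrow> 'v \<Rightarrow> 'v::ab_group_add) \<Rightarrow> ('v \<Rightarrow> ('v \<times> 'v \<Rightarrow>\<^sub>0 'k) set) \<Rightarrow> bool" where
  "linear_to_tensor_square scale \<delta> \<longleftrightarrow>
     (\<forall>x. \<delta> x \<in> tensor_square scale) \<and>
     (\<forall>x y. \<delta> (x + y) = tensor_add scale (\<delta> x) (\<delta> y)) \<and>
     (\<forall>c x. \<delta> (scale c x) = tensor_scale scale c (\<delta> x))"

definition tensor_square_dual ::
    "('k::field \<Rightarrow> 'v \<Rightarrow> 'v::ab_group_add) \<Rightarrow> (('v \<times> 'v \<Rightarrow>\<^sub>0 'k) set \<Rightarrow> 'k) set" where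
  "tensor_square_dual scale = {\<omega>.
     (\<forall>T\<in>tensor_square scale. \<forall>U\<in>tensor_square scale. \<omega> (tensor_add scale T U) = \<omega> T + \<omega> U) \<and>
     (\<forall>c. \<forall>T\<in>tensor_square scale. \<omega> (tensor_scale scale c T) = c * \<omega> T)}"

definition bilinear_map ::
    "('k::field \<Rightarrow> 'v \<Rightarrow> 'v::ab_group_add) \<Rightarrow> ('k \<Rightarrow> 'w \<Rightarrow> 'w::ab_group_add) \<Rightarrow> ('v \<Rightarrow> 'v \<Rightarrow> 'w) \<Rightarrow> bool" where
  "bilinear_map scale sc f \<longleftrightarrow>
     (\<forall>y. Vector_Spaces.linear scale sc (\<lambda>x. f x y)) \<and>
     (\<forall>x. Vector_Spaces.linear scale sc (\<lambda>y. f x y))"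

definition symmetric_tensor ::
    "('k::field \<Rightarrow> 'v \<Rightarrow> 'v::ab_group_add) \<Rightarrow> ('v \<times> 'v \<Rightarrow>\<^sub>0 'k) set \<Rightarrow> bool" where
  "symmetric_tensor scale r \<longleftrightarrow>
     r \<in> tensor_square scale \<and> tensor2 scale (fsweedler r (\<lambda>a b. gen (b, a))) = r"


section \<open>Leibniz algebras and coalgebras\<close>

locale leibniz_algebra = vector_space scale
  for scale :: "'k::field \<Rightarrow> 'v::ab_group_add \<Rightarrow> 'v" +
  fixes br :: "'v \<Rightarrow> 'v \<Rightarrow> 'v"
  assumes bilinear_br: "bilinear_map scale scale br"
    and leibniz: "br x (br y z) = br (br x y) z + br y (br x z)"

locale leibniz_coalgebra = vector_space scale
  for scale :: "'k::field \<Rightarrow> 'v::ab_group_add \<Rightarrow> 'v" +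
  fixes \<delta> :: "'v \<Rightarrow> ('v \<times> 'v \<Rightarrow>\<^sub>0 'k) set"
  assumes linear_delta: "linear_to_tensor_square scale \<delta>"
    and coleibniz:
      "tensor3 scale (fsweedler (\<delta> x) (\<lambda>x1 x2. fsweedler (\<delta> x2) (\<lambda>x21 x22. gen (x1, x21, x22)))) =
       tensor3 scale
         (fsweedler (\<delta> x) (\<lambda>x1 x2. fsweedler (\<delta> x1) (\<lambda>x11 x12. gen (x11, x12, x2))) +
          fsweedler (\<delta> x) (\<lambda>x1 x2. fsweedler (\<delta> x2) (\<lambda>x21 x22. gen (x21, x1, x22))))"


section \<open>Triangular and dual triangular Leibniz bialgebras\<close>

definition cobracket_of ::
    "('k::field \<Rightarrow> 'v \<Rightarrow> 'v::ab_group_add) \<Rightarrow> ('v \<Rightarrow> 'v \<Rightarrow> 'v) \<Rightarrow> ('v \<times> 'v \<Rightarrow>\<^sub>0 'k) set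
      \<Rightarrow> 'v \<Rightarrow> ('v \<times> 'v \<Rightarrow>\<^sub>0 'k) set" where
  "cobracket_of scale br r x = tensor2 scale (fsweedler r (\<lambda>r1 r2.
     - gen (r1, br r2 x) + gen (br r2 x, r1) + gen (br x r2, r1)))"

definition bracket_of ::
    "('k::field \<Rightarrow> 'v \<Rightarrow> 'v::ab_group_add) \<Rightarrow> ('v \<Rightarrow> ('v \<times> 'v \<Rightarrow>\<^sub>0 'k) set) \<Rightarrow> ('v \<Rightarrow> 'v \<Rightarrow> 'k)
      \<Rightarrow> 'v \<Rightarrow> 'v \<Rightarrow> 'v" where
  "bracket_of scale \<delta> \<omega> x y =
     - sweedler scale (\<delta> y) (\<lambda>y1 y2. scale (\<omega> x y1) y2)
     + sweedler scale (\<delta> x) (\<lambda>x1 x2. scale (\<omega> y x1) x2)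
     + sweedler scale (\<delta> x) (\<lambda>x1 x2. scale (\<omega> y x2) x1)"

text \<open>That the two structures below are Leibniz bialgebras is a consequence of their axioms, not
  part of the definition.\<close>

locale triangular_leibniz_bialgebra = leibniz_algebra scale br
  for scale :: "'k::field \<Rightarrow> 'v::ab_group_add \<Rightarrow> 'v" and br +
  fixes r :: "('v \<times> 'v \<Rightarrow>\<^sub>0 'k) set" and \<delta>r :: "'v \<Rightarrow> ('v \<times> 'v \<Rightarrow>\<^sub>0 'k) set"
  assumes symmetric_r: "symmetric_tensor scale r"
    and yang_baxter:
      "tensor3 scale (fsweedler r (\<lambda>r1 r2. fsweedler r (\<lambda>s1 s2.
         gen (r1, br r2 s1, s2) + gen (r1, s1, br r2 s2)))) =
       tensor3 scale (fsweedler r (\<lambda>r1 r2. fsweedler r (\<lambda>s1 s2.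
         gen (br r2 s1, r1, s2) + gen (br r1 s2, s1, r2))))"
    and cobracket: "\<delta>r = cobracket_of scale br r"

locale dual_triangular_leibniz_bialgebra = leibniz_coalgebra scale \<delta>
  for scale :: "'k::field \<Rightarrow> 'v::ab_group_add \<Rightarrow> 'v" and \<delta> +
  fixes \<omega> :: "'v \<Rightarrow> 'v \<Rightarrow> 'k" and br\<omega> :: "'v \<Rightarrow> 'v \<Rightarrow> 'v"
  assumes bilinear_form: "bilinear_map scale (*) \<omega>"
    and symmetric_form: "\<omega> x y = \<omega> y x"
    and co_yang_baxter:
      "sweedler (*) (\<delta> y) (\<lambda>y1 y2. \<omega> x y1 * \<omega> y2 z) + sweedler (*) (\<delta> z) (\<lambda>z1 z2. \<omega> x z1 * \<omega> y z2) =
       sweedler (*) (\<delta> x) (\<lambda>x1 x2. \<omega> y x1 * \<omega> x2 z) + sweedler (*) (\<delta> x) (\<lambda>x1 x2. \<omega> x1 z * \<omega> y x2)"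
    and bracket: "br\<omega> = bracket_of scale \<delta> \<omega>"


section \<open>Cosymplectic and Nijenhuis Leibniz coalgebras\<close>

locale cosymplectic_leibniz_coalgebra = leibniz_coalgebra scale \<delta>
  for scale :: "'k::field \<Rightarrow> 'v::ab_group_add \<Rightarrow> 'v" and \<delta> +
  fixes r :: "('v \<times> 'v \<Rightarrow>\<^sub>0 'k) set"
  assumes symmetric_r: "symmetric_tensor scale r"
    and cosymplectic:
      "tensor3 scale (fsweedler r (\<lambda>r1 r2. fsweedler (\<delta> r1) (\<lambda>r11 r12.
         gen (r11, r12, r2) + gen (r11, r2, r12)))) =
       tensor3 scale (fsweedler r (\<lambda>r1 r2. fsweedler (\<delta> r1) (\<lambda>r11 r12.
         gen (r2, r11, r12) + gen (r2, r12, r11))))"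

locale nijenhuis_leibniz_coalgebra = leibniz_coalgebra scale \<delta>
  for scale :: "'k::field \<Rightarrow> 'v::ab_group_add \<Rightarrow> 'v" and \<delta> +
  fixes S :: "'v \<Rightarrow> 'v"
  assumes linear_S: "Vector_Spaces.linear scale scale S"
    and nijenhuis:
      "tensor2 scale
         (fsweedler (\<delta> x) (\<lambda>x1 x2. gen (S x1, S x2)) +
          fsweedler (\<delta> (S (S x))) (\<lambda>a b. gen (a, b))) =
       tensor2 scale
         (fsweedler (\<delta> (S x)) (\<lambda>a b. gen (S a, b)) +
          fsweedler (\<delta> (S x)) (\<lambda>a b. gen (a, S b)))"

end

theory Submission
  imports Defs
begin

text \<open>Two tensors in \<open>L \<otimes> L\<close> agree as soon as every product \<open>\<alpha> \<otimes> \<beta>\<close> of linear functionals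
  takes the same value on them (\<open>functionals_separate_tensors\<close>). This holds in any dimension, so
  the Nijenhuis identity may be tested on functionals, and the whole argument takes place in the
  dual space, where Sweedler sums become products.

  For functionals \<open>\<alpha>\<close>, \<open>\<beta>\<close> let \<open>\<alpha>\<beta>\<close> be the functional \<open>(\<alpha> \<otimes> \<beta>) \<circ> \<delta>\<close>, let \<open>r(\<alpha>, \<beta>)\<close> be the value
  of \<open>\<alpha> \<otimes> \<beta>\<close> on \<open>r\<close>, and let \<open>R \<alpha> = r\<^sup>1 \<alpha>(r\<^sup>2)\<close>, so that \<open>\<beta>(R \<alpha>) = r(\<beta>, \<alpha>)\<close>. Write \<open>W x = \<omega>(x, -)\<close>.
  Then \<open>S = R \<circ> W\<close>, the transpose \<open>N\<close> of \<open>S\<close> is \<open>W \<circ> R\<close>, and the hypotheses read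
  \<^item> cosymplectic: \<open>r(\<alpha>\<beta>, \<gamma>) + r(\<alpha>\<gamma>, \<beta>) = r(\<beta>\<gamma>, \<alpha>) + r(\<gamma>\<beta>, \<alpha>)\<close>;
  \<^item> Yang-Baxter for \<open>r\<close>: \<open>\<beta>[R \<alpha>, R \<gamma>] + \<gamma>[R \<alpha>, R \<beta>] = \<alpha>[R \<beta>, R \<gamma>] + \<alpha>[R \<gamma>, R \<beta>]\<close>;
  \<^item> co-Yang-Baxter for \<open>\<omega>\<close>: \<open>W\<close> is multiplicative, \<open>W[x, y] = (W x)(W y)\<close>;
  \<^item> the bracket: \<open>\<phi>[x, y] = - ((W x)\<phi>)(y) + ((W y)\<phi>)(x) + (\<phi>(W y))(x)\<close>.

  Put \<open>\<gamma> = W x\<close> in the second identity, so that \<open>R \<gamma> = S x\<close>. The term \<open>\<gamma>[R \<alpha>, R \<beta>]\<close> equals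
  \<open>((N \<alpha>)(N \<beta>))(x)\<close> by multiplicativity. The bracket formula turns the remaining terms into
  \<open>((N \<alpha>)\<beta> + \<alpha>(N \<beta>))(S x)\<close> plus values of \<open>r\<close> on products of \<open>\<alpha>\<close>, \<open>\<beta>\<close> and \<open>W (S x)\<close>. By the
  cosymplectic identity these values add up to \<open>- r(\<alpha>\<beta>, W (S x)) = - (\<alpha>\<beta>)(S (S x))\<close>. The result is
  \<open>(N \<alpha>)(N \<beta>) + N\<^sup>2(\<alpha>\<beta>) = N((N \<alpha>)\<beta> + \<alpha>(N \<beta>))\<close>, which is the Nijenhuis identity for \<open>S\<close>
  evaluated on \<open>\<alpha> \<otimes> \<beta>\<close>.\<close>

section \<open>Functionals and Sweedler sums\<close>

lemma vector_space_mult: "vector_space ((*) :: 'k::field \<Rightarrow> 'k \<Rightarrow> 'k)"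
  by unfold_locales (auto simp: algebra_simps)

abbreviation functional :: "('k::field \<Rightarrow> 'v \<Rightarrow> 'v::ab_group_add) \<Rightarrow> ('v \<Rightarrow> 'k) \<Rightarrow> bool" where
  "functional scale \<alpha> \<equiv> Vector_Spaces.linear scale (*) \<alpha>"

definition pairing ::
    "('v \<Rightarrow> 'k::field) \<Rightarrow> ('v \<Rightarrow> 'k) \<Rightarrow> ('v \<times> 'v \<Rightarrow>\<^sub>0 'k) set \<Rightarrow> 'k" where
  "pairing \<alpha> \<beta> T = sweedler (*) T (\<lambda>a b. \<alpha> a * \<beta> b)"

text \<open>This is \<open>r\<close> regarded as a map from the dual space to \<open>L\<close>. The functional is applied to the
  second leg, as in \<open>S(x) = r\<^sup>1 \<omega>(r\<^sup>2, x)\<close>, so that \<open>S\<close> is the map \<open>x \<mapsto> \<omega>(-, x)\<close> into the dual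
  space followed by this one.\<close>

definition contraction ::
    "('k::field \<Rightarrow> 'v \<Rightarrow> 'v::ab_group_add) \<Rightarrow> ('v \<times> 'v \<Rightarrow>\<^sub>0 'k) set \<Rightarrow> ('v \<Rightarrow> 'k) \<Rightarrow> 'v" where
  "contraction scale r \<alpha> = sweedler scale r (\<lambda>r1 r2. scale (\<alpha> r2) r1)"

lemmas functional_add = Vector_Spaces.linear_iff[THEN iffD1, THEN conjunct2, THEN conjunct2,
  THEN conjunct1, rule_format]
lemmas functional_scale = Vector_Spaces.linear_iff[THEN iffD1, THEN conjunct2, THEN conjunct2,
  THEN conjunct2, rule_format]

lemma linear_lin_ext_comp:
  assumes "Vector_Spaces.linear sc sc' g"
  shows "g (lin_ext sc f t) = lin_ext sc' (\<lambda>i. g (f i)) t"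
proof -
  interpret g: Vector_Spaces.linear sc sc' g by fact
  show ?thesis by (simp add: lin_ext_def g.sum g.scale)
qed

lemma linear_sweedler:
  assumes "Vector_Spaces.linear sc sc' g"
  shows "g (sweedler sc T f) = sweedler sc' T (\<lambda>a b. g (f a b))"
  unfolding sweedler_def linear_lin_ext_comp[OF assms] by (simp add: split_beta')

lemma lin_ext_fsweedler:
  assumes "vector_space sc"
  shows "lin_ext sc f (fsweedler T g) = sweedler sc T (\<lambda>a b. lin_ext sc f (g a b))"
  by (rule linear_sweedler[OF linear_lin_ext[OF assms]])

lemma sweedler_mult_left: "(c :: 'k::field) * sweedler (*) T f = sweedler (*) T (\<lambda>a b. c * f a b)"
  by (simp add: sweedler_def lin_ext_def sum_distrib_left split_beta' mult.left_commute)

lemma sweedler_mult_right: "sweedler (*) T f * (c :: 'k::field) = sweedler (*) T (\<lambda>a b. f a b * c)"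
  by (simp add: sweedler_def lin_ext_def sum_distrib_right split_beta' mult.assoc)

lemma sweedler_add:
  "sweedler (*) T (\<lambda>a b. f a b + g a b) = sweedler (*) T f + sweedler (*) T (g :: _ \<Rightarrow> _ \<Rightarrow> 'k::field)"
  by (simp add: sweedler_def lin_ext_def sum.distrib split_beta' distrib_left)

section \<open>Evaluating tensors on functionals\<close>

text \<open>Well-definedness of \<open>\<alpha> \<otimes> \<beta>\<close> on the quotient: its linear extension to the free space kills the
  bilinearity relations. The next lemma is the same fact for three factors; together they turn the
  tensor axioms into scalar identities.\<close>

lemma lin_ext_tensor2_cong:
  assumes \<alpha>: "functional scale \<alpha>" and \<beta>: "functional scale \<beta>"
    and eq: "tensor2 scale t = tensor2 scale u"
  shows "lin_ext (*) (\<lambda>(a, b). \<alpha> a * \<beta> b) t = lin_ext (*) (\<lambda>(a, b). \<alpha> a * \<beta> b) u"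
proof -
  let ?F = "lin_ext (*) (\<lambda>(a, b). \<alpha> a * \<beta> b)"
  interpret F: Vector_Spaces.linear fscale "(*)" ?F by (rule linear_lin_ext[OF vector_space_mult])
  have "free.span (bilinear_relations scale) \<subseteq> ?F -` {0}"
  proof (rule free.span_minimal)
    show "bilinear_relations scale \<subseteq> ?F -` {0}"
      unfolding bilinear_relations_def
      by (intro subsetI, elim UnE; clarsimp simp: F.diff F.scale lin_ext_gen[OF vector_space_mult]
          functional_add[OF \<alpha>] functional_add[OF \<beta>] functional_scale[OF \<alpha>] functional_scale[OF \<beta>] ring_distribs)
    show "free.subspace (?F -` {0})"
      by (rule F.subspace_vimage) simp
  qed
  moreover have "t - u \<in> free.span (bilinear_relations scale)"
    using eq unfolding tensor2_def by (simp add: coset_eq_iff[OF free.subspace_span])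
  ultimately have "?F (t - u) = 0" by blast
  then show ?thesis by (simp add: F.diff)
qed

lemma lin_ext_tensor3_cong:
  assumes \<alpha>: "functional scale \<alpha>" and \<beta>: "functional scale \<beta>" and \<gamma>: "functional scale \<gamma>"
    and eq: "tensor3 scale t = tensor3 scale u"
  shows "lin_ext (*) (\<lambda>(a, b, c). \<alpha> a * \<beta> b * \<gamma> c) t = lin_ext (*) (\<lambda>(a, b, c). \<alpha> a * \<beta> b * \<gamma> c) u"
proof -
  let ?F = "lin_ext (*) (\<lambda>(a, b, c). \<alpha> a * \<beta> b * \<gamma> c)"
  interpret F: Vector_Spaces.linear fscale "(*)" ?F by (rule linear_lin_ext[OF vector_space_mult])
  have "free.span (trilinear_relations scale) \<subseteq> ?F -` {0}"
  proof (rule free.span_minimal)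
    show "trilinear_relations scale \<subseteq> ?F -` {0}"
      unfolding trilinear_relations_def
      by (intro subsetI, elim UnE; clarsimp simp: F.diff F.scale lin_ext_gen[OF vector_space_mult]
          functional_add[OF \<alpha>] functional_add[OF \<beta>] functional_add[OF \<gamma>]
          functional_scale[OF \<alpha>] functional_scale[OF \<beta>] functional_scale[OF \<gamma>] ring_distribs)
    show "free.subspace (?F -` {0})"
      by (rule F.subspace_vimage) simp
  qed
  moreover have "t - u \<in> free.span (trilinear_relations scale)"
    using eq unfolding tensor3_def by (simp add: coset_eq_iff[OF free.subspace_span])
  ultimately have "?F (t - u) = 0" by blast
  then show ?thesis by (simp add: F.diff)
qed

lemma tensor2_rep: "T \<in> tensor_square scale \<Longrightarrow> tensor2 scale (rep T) = T"
  unfolding tensor_square_def tensor2_def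
  using coset_eq_iff[OF free.subspace_span, THEN iffD2, OF rep_coset[OF free.subspace_span]] by blast

lemma pairing_tensor2:
  assumes "functional scale \<alpha>" "functional scale \<beta>"
  shows "pairing \<alpha> \<beta> (tensor2 scale t) = lin_ext (*) (\<lambda>(a, b). \<alpha> a * \<beta> b) t"
  unfolding pairing_def sweedler_def
  by (rule lin_ext_tensor2_cong[OF assms]) (simp add: tensor2_rep tensor_square_def)

section \<open>Functionals separate tensors\<close>

text \<open>Used below with \<open>N\<close> the span of the bilinearity relations: it allows a basis expansion to be
  carried out in one argument of a generator \<open>gen (x, y)\<close>, up to \<open>N\<close>.\<close>

lemma (in vector_space) linear_congruence_sum:
  assumes N: "free.subspace N" and "finite A"
    and add: "\<And>x y. f (x + y) - f x - f y \<in> N"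
    and scl: "\<And>c x. f (scale c x) - fscale c (f x) \<in> N"
  shows "f (\<Sum>b\<in>A. scale (c b) (v b)) - (\<Sum>b\<in>A. fscale (c b) (f (v b))) \<in> N"
  using \<open>finite A\<close>
proof induction
  case empty
  show ?case using scl[of 0 0] by (simp add: free.scale_zero_left)
next
  case (insert b A)
  let ?s = "\<Sum>b\<in>A. scale (c b) (v b)"
  have "(f (scale (c b) (v b) + ?s) - f (scale (c b) (v b)) - f ?s)
      + (f (scale (c b) (v b)) - fscale (c b) (f (v b)))
      + (f ?s - (\<Sum>b\<in>A. fscale (c b) (f (v b)))) \<in> N"
    by (intro free.subspace_add[OF N] add scl insert.IH)
  then show ?case using insert.hyps by (simp add: algebra_simps)
qed

text \<open>Fix a basis \<open>B\<close>. Expanding both arguments of each generator shows that, modulo the relations,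
  \<open>t\<close> is congruent to a combination of the generators \<open>gen (b, c)\<close> with \<open>b\<close>, \<open>c\<close> in \<open>B\<close>. Its
  coefficients are the values on \<open>t\<close> of products of coordinate functionals, so the hypothesis
  already forces equal normal forms for \<open>t\<close> and \<open>u\<close>.\<close>

theorem (in vector_space) functionals_separate_tensors:
  assumes "\<And>\<alpha> \<beta>. functional scale \<alpha> \<Longrightarrow> functional scale \<beta> \<Longrightarrow>
      lin_ext (*) (\<lambda>(a, b). \<alpha> a * \<beta> b) t = lin_ext (*) (\<lambda>(a, b). \<alpha> a * \<beta> b) u"
  shows "tensor2 scale t = tensor2 scale u"
proof -
  let ?N = "free.span (bilinear_relations scale)"
  note N = free.subspace_span[of "bilinear_relations scale"]
  define B where "B = extend_basis ({} :: 'b set)"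
  have B: "independent B" "span B = UNIV"
    unfolding B_def
    by (rule independent_extend_basis span_extend_basis, rule independent_empty)+
  let ?R = "representation B"
  have fin: "finite {b. ?R x b \<noteq> 0}" for x
    by (rule finite_representation)
  have expand: "(\<Sum>b | ?R x b \<noteq> 0. scale (?R x b) b) = x" for x
    using B by (intro sum_nonzero_representation_eq) auto
  have coord: "functional scale (\<lambda>x. ?R x b)" for b
    using B by (rule linear_representation)
  define G where "G = (\<lambda>(x, y).
    \<Sum>b | ?R x b \<noteq> 0. fscale (?R x b) (\<Sum>c | ?R y c \<noteq> 0. fscale (?R y c) (gen (b, c))))"
  \<comment> \<open>\<open>G (x, y)\<close> is the expansion of \<open>x \<otimes> y\<close> in the basis, and \<open>?P\<close> the resulting normal form map\<close>
  let ?P = "lin_ext fscale G"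
  have rel:
    "gen (x + x', y) - gen (x, y) - gen (x', y) \<in> ?N"
    "gen (x, y + y') - gen (x, y) - gen (x, y') \<in> ?N"
    "gen (scale c x, y) - fscale c (gen (x, y)) \<in> ?N"
    "gen (x, scale c y) - fscale c (gen (x, y)) \<in> ?N" for x x' y y' c
    unfolding bilinear_relations_def by (rule free.span_base, blast)+
  have G: "gen (x, y) - G (x, y) \<in> ?N" for x y
  proof -
    have 1: "gen (x, y) - (\<Sum>b | ?R x b \<noteq> 0. fscale (?R x b) (gen (b, y))) \<in> ?N"
      using linear_congruence_sum[OF N fin[of x], where f="\<lambda>x. gen (x, y)" and c="?R x" and v="\<lambda>b. b"] rel
      by (simp add: expand)
    have 2: "gen (b, y) - (\<Sum>c | ?R y c \<noteq> 0. fscale (?R y c) (gen (b, c))) \<in> ?N" for b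
      using linear_congruence_sum[OF N fin[of y], where f="\<lambda>y. gen (b, y)" and c="?R y" and v="\<lambda>b. b"] rel
      by (simp add: expand)
    have "(\<Sum>b | ?R x b \<noteq> 0. fscale (?R x b) (gen (b, y))) - G (x, y) \<in> ?N"
      unfolding G_def prod.case sum_subtractf[symmetric] free.scale_right_diff_distrib[symmetric]
      by (intro free.subspace_sum[OF N] free.subspace_scale[OF N] 2)
    from free.subspace_add[OF N 1 this] show ?thesis by simp
  qed
  have reduce: "w - ?P w \<in> ?N" for w
  proof -
    have "w - ?P w = lin_ext fscale (\<lambda>i. gen i - G i) w"
    proof -
      have "w = lin_ext fscale gen w"
        unfolding lin_ext_def
        by (rule poly_mapping_eqI) (simp add: lookup_sum lookup_single when_def in_keys_iff if_distrib cong: if_cong)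
      then have "w - ?P w = lin_ext fscale gen w - ?P w" by simp
      also have "\<dots> = lin_ext fscale (\<lambda>i. gen i - G i) w"
        by (simp add: lin_ext_def sum_subtractf free.scale_right_diff_distrib)
      finally show ?thesis .
    qed
    also have "\<dots> \<in> ?N"
      unfolding lin_ext_def using G
      by (intro free.subspace_sum[OF N] free.subspace_scale[OF N]) auto
    finally show ?thesis .
  qed
  have lookup_G: "Poly_Mapping.lookup (G i) (b, c) = (case i of (x, y) \<Rightarrow> ?R x b * ?R y c)" for i b c
  proof -
    obtain x y where i: "i = (x, y)" by (cases i)
    have "Poly_Mapping.lookup (G i) (b, c) =
        (\<Sum>b' | ?R x b' \<noteq> 0. ?R x b' * (\<Sum>c' | ?R y c' \<noteq> 0. ?R y c' * (if b' = b \<and> c' = c then 1 else 0)))"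
      by (simp add: i G_def lookup_sum lookup_single when_def)
    also have "\<dots> = (\<Sum>b' | ?R x b' \<noteq> 0. ?R x b' * (if b' = b then ?R y c else 0))"
      using fin[of y]
      by (intro sum.cong refl arg_cong[where f="(*) _"])
        (auto simp: if_distrib if_bool_eq_conj cong: if_cong)
    also have "\<dots> = ?R x b * ?R y c"
      using fin[of x] by (simp add: if_distrib cong: if_cong)
    finally show ?thesis by (simp add: i)
  qed
  have lookup_linear: "Vector_Spaces.linear fscale (*) (\<lambda>w. Poly_Mapping.lookup w i)" for i :: "'b \<times> 'b"
    by (rule Vector_Spaces.linear_iff[THEN iffD2])
      (simp add: vector_space_fscale vector_space_mult lookup_add)
  have "?P t = ?P u"
  proof (rule poly_mapping_eqI)
    fix i :: "'b \<times> 'b"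
    obtain b c where i: "i = (b, c)" by (cases i)
    show "Poly_Mapping.lookup (?P t) i = Poly_Mapping.lookup (?P u) i"
      unfolding linear_lin_ext_comp[OF lookup_linear] i lookup_G
      by (rule assms[OF coord coord])
  qed
  then have "t - u = (t - ?P t) - (u - ?P u)" by simp
  then have "t - u \<in> ?N" using free.subspace_diff[OF N reduce reduce] by metis
  then show ?thesis unfolding tensor2_def by (simp add: coset_eq_iff[OF N])
qed

section \<open>The axioms on the dual space\<close>

text \<open>The functional is the product \<open>\<alpha>\<beta>\<close> that \<open>\<delta>\<close> induces on the dual space. Linearity needs
  an argument because \<open>\<delta>\<close> is additive only for the sum of cosets, which is formed with chosen
  representatives.\<close>

lemma (in leibniz_coalgebra) functional_dual_product:
  assumes "functional scale \<alpha>" "functional scale \<beta>"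
  shows "functional scale (\<lambda>x. pairing \<alpha> \<beta> (\<delta> x))"
proof -
  interpret F: Vector_Spaces.linear fscale "(*)" "lin_ext (*) (\<lambda>(a, b). \<alpha> a * \<beta> b)"
    by (rule linear_lin_ext[OF vector_space_mult])
  have "\<delta> (x + y) = tensor2 scale (rep (\<delta> x) + rep (\<delta> y))"
    "\<delta> (scale c x) = tensor2 scale (fscale c (rep (\<delta> x)))" for x y c
    using linear_delta by (auto simp: linear_to_tensor_square_def tensor_add_def tensor_scale_def)
  then show ?thesis
    by (intro Vector_Spaces.linear_iff[THEN iffD2])
      (simp add: vector_space_axioms vector_space_mult pairing_tensor2[OF assms] F.add F.scale,
        simp add: pairing_def sweedler_def)
qed

lemma functional_contraction:
  assumes "functional scale \<beta>"
  shows "\<beta> (contraction scale r \<alpha>) = pairing \<beta> \<alpha> r"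
  by (simp add: contraction_def linear_sweedler[OF assms] pairing_def functional_scale[OF assms] mult.commute)

lemma pairing_commute:
  assumes r: "symmetric_tensor scale r" and "functional scale \<alpha>" "functional scale \<beta>"
  shows "pairing \<alpha> \<beta> r = pairing \<beta> \<alpha> r"
proof -
  have "pairing \<alpha> \<beta> r = pairing \<alpha> \<beta> (tensor2 scale (fsweedler r (\<lambda>a b. gen (b, a))))"
    using r by (simp add: symmetric_tensor_def)
  also have "\<dots> = pairing \<beta> \<alpha> r"
    unfolding pairing_tensor2[OF assms(2,3)]
    by (simp add: lin_ext_fsweedler[OF vector_space_mult] lin_ext_gen[OF vector_space_mult] pairing_def mult.commute)
  finally show ?thesis .
qed

lemma lin_ext_mult_add: "lin_ext (*) f (t + u) = lin_ext (*) f t + (lin_ext (*) f u :: 'k::field)"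
  by (rule functional_add[OF linear_lin_ext[OF vector_space_mult]])

lemmas evaluate = lin_ext_fsweedler[OF vector_space_mult] lin_ext_mult_add
  lin_ext_gen[OF vector_space_mult] sweedler_add

lemma (in cosymplectic_leibniz_coalgebra) cosymplectic_functional:
  assumes \<alpha>: "functional scale \<alpha>" and \<beta>: "functional scale \<beta>" and \<gamma>: "functional scale \<gamma>"
  shows "pairing (\<lambda>x. pairing \<alpha> \<beta> (\<delta> x)) \<gamma> r + pairing (\<lambda>x. pairing \<alpha> \<gamma> (\<delta> x)) \<beta> r =
         pairing (\<lambda>x. pairing \<beta> \<gamma> (\<delta> x)) \<alpha> r + pairing (\<lambda>x. pairing \<gamma> \<beta> (\<delta> x)) \<alpha> r"
  using lin_ext_tensor3_cong[OF assms cosymplectic]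
  by (simp add: evaluate pairing_def sweedler_mult_left sweedler_mult_right mult_ac)

text \<open>Each term of the Yang-Baxter equation has a bracket in one leg and one free leg from each of
  the two copies of \<open>r\<close>. Evaluating the free legs contracts the copies with two of the functionals,
  which leaves the third functional on a bracket of contractions. The symmetry of \<open>r\<close> is what makes
  it immaterial which leg of a copy enters the bracket.\<close>

lemma (in triangular_leibniz_bialgebra) yang_baxter_functional:
  assumes \<alpha>: "functional scale \<alpha>" and \<beta>: "functional scale \<beta>" and \<gamma>: "functional scale \<gamma>"
  shows "\<beta> (br (contraction scale r \<alpha>) (contraction scale r \<gamma>))
       + \<gamma> (br (contraction scale r \<alpha>) (contraction scale r \<beta>))
       = \<alpha> (br (contraction scale r \<beta>) (contraction scale r \<gamma>)
            + br (contraction scale r \<gamma>) (contraction scale r \<beta>))"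
proof -
  let ?R = "contraction scale r"
  have br_left: "Vector_Spaces.linear scale scale (\<lambda>x. br x y)"
    and br_right: "Vector_Spaces.linear scale scale (br x)" for x y
    using bilinear_br by (auto simp: bilinear_map_def)
  have fbl: "functional scale (\<lambda>x. \<phi> (br x y))" and fbr: "functional scale (\<lambda>y. \<phi> (br x y))"
    if "functional scale \<phi>" for \<phi> x y
    using Vector_Spaces.linear_compose[OF br_left that] Vector_Spaces.linear_compose[OF br_right that]
    by (simp_all add: o_def)
  \<comment> \<open>by symmetry \<open>\<psi>\<close> may be applied to either leg of \<open>r\<close>; the primed forms exchange the two legs\<close>
  have left: "\<phi> (br (?R \<psi>) w) = sweedler (*) r (\<lambda>a b. \<psi> a * \<phi> (br b w))"
    and left': "\<phi> (br (?R \<psi>) w) = sweedler (*) r (\<lambda>a b. \<psi> b * \<phi> (br a w))"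
    and right: "\<phi> (br w (?R \<psi>)) = sweedler (*) r (\<lambda>a b. \<phi> (br w a) * \<psi> b)"
    and right': "\<phi> (br w (?R \<psi>)) = sweedler (*) r (\<lambda>a b. \<phi> (br w b) * \<psi> a)"
    if "functional scale \<phi>" "functional scale \<psi>" for \<phi> \<psi> w
    using pairing_commute[OF symmetric_r fbl[OF that(1)] that(2)]
      pairing_commute[OF symmetric_r fbr[OF that(1)] that(2)]
    by (simp_all add: functional_contraction[OF fbl[OF that(1)]]
        functional_contraction[OF fbr[OF that(1)]] pairing_def mult.commute)
  have "\<beta> (br (?R \<alpha>) (?R \<gamma>)) =
      sweedler (*) r (\<lambda>r1 r2. sweedler (*) r (\<lambda>s1 s2. \<alpha> r1 * \<beta> (br r2 s1) * \<gamma> s2))"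
    by (simp only: left[OF \<beta> \<alpha>], simp add: right[OF \<beta> \<gamma>] sweedler_mult_left mult_ac)
  moreover have "\<gamma> (br (?R \<alpha>) (?R \<beta>)) =
      sweedler (*) r (\<lambda>r1 r2. sweedler (*) r (\<lambda>s1 s2. \<alpha> r1 * \<beta> s1 * \<gamma> (br r2 s2)))"
    by (simp only: left[OF \<gamma> \<alpha>], simp add: right'[OF \<gamma> \<beta>] sweedler_mult_left mult_ac)
  moreover have "\<alpha> (br (?R \<beta>) (?R \<gamma>)) =
      sweedler (*) r (\<lambda>r1 r2. sweedler (*) r (\<lambda>s1 s2. \<alpha> (br r2 s1) * \<beta> r1 * \<gamma> s2))"
    by (simp only: left[OF \<alpha> \<beta>], simp add: right[OF \<alpha> \<gamma>] sweedler_mult_left mult_ac)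
  moreover have "\<alpha> (br (?R \<gamma>) (?R \<beta>)) =
      sweedler (*) r (\<lambda>r1 r2. sweedler (*) r (\<lambda>s1 s2. \<alpha> (br r1 s2) * \<beta> s1 * \<gamma> r2))"
    by (simp only: left'[OF \<alpha> \<gamma>], simp add: right'[OF \<alpha> \<beta>] sweedler_mult_left mult_ac)
  ultimately show ?thesis
    using lin_ext_tensor3_cong[OF assms yang_baxter]
    by (simp add: evaluate functional_add[OF \<alpha>])
qed

lemma (in dual_triangular_leibniz_bialgebra) functional_form:
  "functional scale (\<omega> x)"
  using bilinear_form by (auto simp: bilinear_map_def)

lemma (in dual_triangular_leibniz_bialgebra) functional_bracket:
  assumes \<phi>: "functional scale \<phi>"
  shows "\<phi> (br\<omega> x y) = - pairing (\<omega> x) \<phi> (\<delta> y) + pairing (\<omega> y) \<phi> (\<delta> x) + pairing \<phi> (\<omega> y) (\<delta> x)"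
proof -
  interpret \<phi>: Vector_Spaces.linear scale "(*)" \<phi> by fact
  show ?thesis
    by (simp add: bracket bracket_of_def \<phi>.add \<phi>.diff \<phi>.neg \<phi>.scale linear_sweedler[OF \<phi>] pairing_def mult.commute)
qed

text \<open>The co-Yang-Baxter equation says that \<open>x \<mapsto> \<omega>(x, -)\<close> is multiplicative: its second term is
  the product of \<open>\<omega>(x, -)\<close> and \<open>\<omega>(y, -)\<close> at \<open>z\<close>, and the other three make up \<open>\<omega>([x, y], z)\<close>.\<close>

lemma (in dual_triangular_leibniz_bialgebra) form_bracket:
  "\<omega> z (br\<omega> x y) = pairing (\<omega> x) (\<omega> y) (\<delta> z)"
  using co_yang_baxter[where x=x and y=y and z=z]
  by (simp add: functional_bracket[OF functional_form] pairing_def symmetric_form[of _ z] algebra_simps)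

section \<open>The Nijenhuis identity\<close>

theorem theorem3p15:
  fixes scale :: "'k::field \<Rightarrow> 'v::ab_group_add \<Rightarrow> 'v"
    and \<delta> :: "'v \<Rightarrow> ('v \<times> 'v \<Rightarrow>\<^sub>0 'k) set"
    and r :: "('v \<times> 'v \<Rightarrow>\<^sub>0 'k) set"
    and \<omega> :: "('v \<times> 'v \<Rightarrow>\<^sub>0 'k) set \<Rightarrow> 'k"
    and form :: "'v \<Rightarrow> 'v \<Rightarrow> 'k"
    and br\<omega> :: "'v \<Rightarrow> 'v \<Rightarrow> 'v"
    and \<delta>r :: "'v \<Rightarrow> ('v \<times> 'v \<Rightarrow>\<^sub>0 'k) set"
    and S :: "'v \<Rightarrow> 'v"
  assumes "cosymplectic_leibniz_coalgebra scale \<delta> r"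
    and "\<omega> \<in> tensor_square_dual scale"
    and "\<And>x y. form x y = \<omega> (pure2 scale x y)"
    and "\<And>x y. br\<omega> x y =
           - sweedler scale (\<delta> y) (\<lambda>y1 y2. scale (form x y1) y2)
           + sweedler scale (\<delta> x) (\<lambda>x1 x2. scale (form y x1) x2)
           + sweedler scale (\<delta> x) (\<lambda>x1 x2. scale (form y x2) x1)"
    and "dual_triangular_leibniz_bialgebra scale \<delta> form br\<omega>"
    and "\<And>x. \<delta>r x = tensor2 scale (fsweedler r (\<lambda>r1 r2.
           - gen (r1, br\<omega> r2 x) + gen (br\<omega> r2 x, r1) + gen (br\<omega> x r2, r1)))"
    and "triangular_leibniz_bialgebra scale br\<omega> r \<delta>r"
    and "\<And>x. S x = sweedler scale r (\<lambda>r1 r2. scale (form r2 x) r1)"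
  shows "nijenhuis_leibniz_coalgebra scale \<delta> S"
proof -
  interpret cosymplectic_leibniz_coalgebra scale \<delta> r by fact
  interpret D: dual_triangular_leibniz_bialgebra scale \<delta> form br\<omega> by fact
  interpret T: triangular_leibniz_bialgebra scale br\<omega> r \<delta>r by fact
  let ?R = "contraction scale r"
  have form_commute: "form x y = form y x" for x y by (rule D.symmetric_form)
  have S_eq: "S x = ?R (form x)" for x
    by (simp add: assms(8) contraction_def form_commute[of x])
  have functional_form: "functional scale (form x)" for x by (rule D.functional_form)
  have functional_S: "\<phi> (S x) = pairing \<phi> (form x) r" if "functional scale \<phi>" for \<phi> x
    by (simp add: S_eq functional_contraction[OF that])
  have form_R: "form (?R \<phi>) = (\<lambda>x. \<phi> (S x))" if "functional scale \<phi>" for \<phi>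
    by (simp add: fun_eq_iff form_commute[of "?R \<phi>"] functional_contraction[OF functional_form]
        functional_S[OF that] pairing_commute[OF symmetric_r that functional_form])
  have linear_S: "Vector_Spaces.linear scale scale S"
    by (rule Vector_Spaces.linear_iff[THEN iffD2])
      (simp add: vector_space_axioms assms(8) sweedler_def lin_ext_def split_beta'
        functional_add[OF functional_form] functional_scale[OF functional_form]
        scale_left_distrib scale_right_distrib sum.distrib scale_sum_right mult_ac)
  have nijenhuis_functional:
    "pairing (\<lambda>x. \<alpha> (S x)) (\<lambda>x. \<beta> (S x)) (\<delta> x) + pairing \<alpha> \<beta> (\<delta> (S (S x))) =
     pairing (\<lambda>x. \<alpha> (S x)) \<beta> (\<delta> (S x)) + pairing \<alpha> (\<lambda>x. \<beta> (S x)) (\<delta> (S x))"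
    if \<alpha>: "functional scale \<alpha>" and \<beta>: "functional scale \<beta>" for \<alpha> \<beta> x
  proof -
    \<comment> \<open>Yang-Baxter with third functional \<open>\<omega>(x, -)\<close>, whose contraction is \<open>S x\<close>\<close>
    have "\<beta> (br\<omega> (?R \<alpha>) (S x)) + form x (br\<omega> (?R \<alpha>) (?R \<beta>)) =
        \<alpha> (br\<omega> (?R \<beta>) (S x) + br\<omega> (S x) (?R \<beta>))"
      using T.yang_baxter_functional[OF \<alpha> \<beta> functional_form[of x]] by (simp add: S_eq)
    moreover have "form x (br\<omega> (?R \<alpha>) (?R \<beta>)) = pairing (\<lambda>x. \<alpha> (S x)) (\<lambda>x. \<beta> (S x)) (\<delta> x)"
      by (simp add: D.form_bracket form_R[OF \<alpha>] form_R[OF \<beta>])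
    moreover have "\<beta> (br\<omega> (?R \<alpha>) (S x)) = - pairing (\<lambda>x. \<alpha> (S x)) \<beta> (\<delta> (S x))
        + pairing (\<lambda>y. pairing (form (S x)) \<beta> (\<delta> y)) \<alpha> r
        + pairing (\<lambda>y. pairing \<beta> (form (S x)) (\<delta> y)) \<alpha> r"
      by (simp add: D.functional_bracket[OF \<beta>] form_R[OF \<alpha>]
          functional_contraction[OF functional_dual_product[OF functional_form \<beta>]]
          functional_contraction[OF functional_dual_product[OF \<beta> functional_form]])
    moreover have "\<alpha> (br\<omega> (?R \<beta>) (S x) + br\<omega> (S x) (?R \<beta>)) =
        pairing \<alpha> (\<lambda>x. \<beta> (S x)) (\<delta> (S x)) + pairing (\<lambda>y. pairing \<alpha> (form (S x)) (\<delta> y)) \<beta> r"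
      by (simp add: functional_add[OF \<alpha>] D.functional_bracket[OF \<alpha>] form_R[OF \<beta>]
          functional_contraction[OF functional_dual_product[OF \<alpha> functional_form]])
    moreover have "pairing \<alpha> \<beta> (\<delta> (S (S x))) = pairing (\<lambda>y. pairing \<alpha> \<beta> (\<delta> y)) (form (S x)) r"
      by (rule functional_S[OF functional_dual_product[OF \<alpha> \<beta>]])
    moreover note cosymplectic_functional[OF \<alpha> \<beta> functional_form[of "S x"]]
    ultimately show ?thesis by algebra
  qed
  show ?thesis
  proof (intro nijenhuis_leibniz_coalgebra.intro nijenhuis_leibniz_coalgebra_axioms.intro
      leibniz_coalgebra_axioms linear_S)
    show "tensor2 scale (fsweedler (\<delta> x) (\<lambda>x1 x2. gen (S x1, S x2)) +
          fsweedler (\<delta> (S (S x))) (\<lambda>a b. gen (a, b))) =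
       tensor2 scale (fsweedler (\<delta> (S x)) (\<lambda>a b. gen (S a, b)) +
          fsweedler (\<delta> (S x)) (\<lambda>a b. gen (a, S b)))" for x
      using nijenhuis_functional[where x=x]
      by (intro functionals_separate_tensors) (simp add: evaluate pairing_def)
  qed
qed

end
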